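(* Let $n\ge 6$ and $3\le k\le n-2$ be integers, and let $T$ be a tree on $n$ vertices having exactly $k$ segments. Then \[ R_{\alpha}^{0}(T) \begin{cases} \le 2^{\alpha}n+k^{\alpha}-(2^{\alpha}-1)k-2^{\alpha} & \text{if $\alpha<0$ or $\alpha>1$,}\\ \ge 2^{\alpha}n+k^{\alpha}-(2^{\alpha}-1)k-2^{\alpha} & \text{if $0<\alpha<1$,} \end{cases} \] and, for $a>1$, \[ SEI_{a}(T)\le 2a^{2}n+ka^{k}-(2a-1)ak-2a^{2}. \] Equality holds in any of these inequalities if and only if $T$ has degree sequence $(k,\underbrace{2,\dots,2}_{n-k-1},\underbrace{1,\dots,1}_{k})$.
   Context: For a graph $G$ and vertex $v$, $d_v$ denotes the degree of $v$. A pendent vertex has degree $1$ and a branching vertex has degree greater than $2$. A segment of a tree is a path subgraph $P$ whose two end vertices are each branching or pendent and all of whose internal vertices (if any) have degree $2$ in the tree. The degree sequence of a graph is the list of its vertex degrees in nonincreasing order. The zeroth-order general Randić index is $R_{\alpha}^{0}(G)=\sum_{v\in V(G)} d_v^{\alpha}$, where $\alpha$ is a real number with $\alpha\ne 0,1$. The variable sum exdeg index is $SEI_{a}(G)=\sum_{v\in V(G)} d_v a^{d_v}$, where $a>0$, $a\neq 1$. *)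

theory Defs
  imports Complex_Main "HOL-Library.Multiset" "Graph_Theory.Graph_Theory"
begin

text \<open>
  A finite simple graph is an irreflexive symmetric digraph, i.e. a \<^locale>\<open>pair_graph\<close>:
  every undirected edge uv is stored as the two arcs (u,v) and (v,u).  Hence the undirected
  degree of a vertex is its out-degree.
\<close>

abbreviation deg :: "'a pair_pre_digraph \<Rightarrow> 'a \<Rightarrow> nat" where
  "deg G v \<equiv> out_degree (with_proj G) v"

text \<open>
  The library predicate \<^const>\<open>Digraph_Component.tree\<close> is not usable for symmetric digraphs,
  since it regards the closed walk u,v,u along a single edge as a cycle.  In a simple graph
  the closed walks of length at least 3 without repeated vertices are exactly the cycles.
\<close>

definition is_tree :: "'a pair_pre_digraph \<Rightarrow> bool" where
  "is_tree T \<longleftrightarrow> pair_graph T \<and> Digraph_Component.connected (with_proj T) \<and>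
     \<not> (\<exists>p. pre_digraph.cycle (with_proj T) p \<and> 3 \<le> length p)"

definition pendent :: "'a pair_pre_digraph \<Rightarrow> 'a \<Rightarrow> bool" where
  "pendent G v \<longleftrightarrow> deg G v = 1"

definition branching :: "'a pair_pre_digraph \<Rightarrow> 'a \<Rightarrow> bool" where
  "branching G v \<longleftrightarrow> deg G v > 2"

definition path_graph :: "'a list \<Rightarrow> 'a pair_pre_digraph" where
  "path_graph xs = \<lparr> pverts = set xs, parcs = set (vwalk_arcs xs) \<union> (set (vwalk_arcs xs))\<inverse> \<rparr>"

text \<open>
  Segments are subgraphs rather than vertex sequences, so a path and its reversal give the
  same segment.  A segment has two end vertices, hence at least one edge.
\<close>

definition is_segment :: "'a pair_pre_digraph \<Rightarrow> 'a pair_pre_digraph \<Rightarrow> bool" where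
  "is_segment T P \<longleftrightarrow> subgraph (with_proj P) (with_proj T) \<and>
     (\<exists>xs. distinct xs \<and> 2 \<le> length xs \<and> P = path_graph xs \<and>
        (branching T (hd xs) \<or> pendent T (hd xs)) \<and>
        (branching T (last xs) \<or> pendent T (last xs)) \<and>
        (\<forall>v \<in> set (butlast (tl xs)). deg T v = 2))"

definition degree_sequence :: "'a pair_pre_digraph \<Rightarrow> nat list" where
  "degree_sequence G =
     rev (sorted_list_of_multiset (image_mset (deg G) (mset_set (pverts G))))"

definition zeroth_order_Randic :: "real \<Rightarrow> 'a pair_pre_digraph \<Rightarrow> real" where
  "zeroth_order_Randic \<alpha> G = (\<Sum>v\<in>pverts G. real (deg G v) powr \<alpha>)"

definition SEI :: "real \<Rightarrow> 'a pair_pre_digraph \<Rightarrow> real" where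
  "SEI a G = (\<Sum>v\<in>pverts G. real (deg G v) * a ^ deg G v)"

end

theory Submission
  imports Defs
begin

text \<open>
  An oriented segment is determined by its first arc, and every arc leaving a vertex of degree
  different from 2 starts one: follow vertices of degree 2 until this is no longer possible.
  Each segment has exactly two orientations, so the degrees different from 2 sum to \<open>2k\<close>.
  As all degrees sum to \<open>2(n - 1)\<close>, exactly \<open>k + 1\<close> vertices have degree different from 2.
  Among \<open>k + 1\<close> positive integers with sum \<open>2k\<close>, a strictly convex function has the largest sum
  exactly at \<open>(k, 1, \<dots>, 1)\<close>.
\<close>

section \<open>Paths and leaves in a cycle-free relation\<close>

definition is_path :: "'a rel \<Rightarrow> 'a list \<Rightarrow> bool" where
  "is_path E xs \<longleftrightarrow> distinct xs \<and> successively (\<lambda>x y. (x, y) \<in> E) xs"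

text \<open>A cycle is a path together with an arc from its last vertex back to its first, so the
  start is not repeated in the list. Length at least 3 excludes going back and forth along one edge
  of a symmetric relation.\<close>

definition cycle_free :: "'a rel \<Rightarrow> bool" where
  "cycle_free E \<longleftrightarrow> (\<forall>xs. is_path E xs \<longrightarrow> 3 \<le> length xs \<longrightarrow> (last xs, hd xs) \<notin> E)"

text \<open>If \<open>w\<close> already lay on the path, its stretch from \<open>w\<close> to
  \<open>z\<close> would be closed to a cycle by the arc \<open>(z, w)\<close>; as \<open>w\<close>
  is neither \<open>y\<close> nor \<open>z\<close>, that stretch has at least three
  vertices.\<close>

lemma is_path_snoc:
  assumes "cycle_free E" "irrefl E" "is_path E (xs @ [y, z])" "(z, w) \<in> E" "w \<noteq> y"
  shows "is_path E (xs @ [y, z, w])"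
proof -
  have "w \<noteq> z" using assms(2,4) by (auto simp: irrefl_def)
  moreover have "w \<notin> set xs"
  proof
    assume "w \<in> set xs"
    then obtain as bs where xs: "xs = as @ w # bs" by (meson split_list)
    have "is_path E (w # bs @ [y, z])"
      using assms(3) unfolding is_path_def xs by (auto simp: successively_append_iff)
    then show False using assms(1,4) unfolding cycle_free_def by fastforce
  qed
  ultimately show ?thesis
    using assms(3-5) unfolding is_path_def by (auto simp: successively_append_iff)
qed

lemma is_path_subset:
  assumes "is_path E xs" "E \<subseteq> V \<times> V" "2 \<le> length xs"
  shows "set xs \<subseteq> V"
proof
  fix v assume "v \<in> set xs"
  then obtain i where i: "i < length xs" "v = xs ! i" by (auto simp: in_set_conv_nth)
  have nth: "\<And>j. Suc j < length xs \<Longrightarrow> (xs ! j, xs ! Suc j) \<in> E"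
    using assms(1) unfolding is_path_def by (auto dest: successively_nth)
  show "v \<in> V"
  proof (cases i)
    case 0
    then show ?thesis using nth[of 0] assms(2,3) i by auto
  next
    case (Suc j)
    then show ?thesis using nth[of j] assms(2) i by auto
  qed
qed

text \<open>A path has distinct vertices in \<open>V\<close>, so \<open>card V\<close> bounds its
  length. The predicate \<open>P\<close> is left open because both the search for a leaf and the
  construction of segments take a longest path of some kind.\<close>

lemma longest_path:
  assumes "finite V" "E \<subseteq> V \<times> V" "P xs" "\<And>xs. P xs \<Longrightarrow> is_path E xs \<and> 2 \<le> length xs"
  obtains ys where "P ys" "\<And>zs. P zs \<Longrightarrow> length zs \<le> length ys"
proof -
  have "length zs < Suc (card V)" if "P zs" for zs
    using assms(4)[OF that] is_path_subset[OF _ assms(2)] assms(1)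
    by (metis card_mono distinct_card is_path_def less_Suc_eq_le)
  then have "\<exists>ys. P ys \<and> (\<forall>zs. P zs \<longrightarrow> length zs \<le> length ys)"
    using ex_has_greatest_nat[of P xs length "Suc (card V)"] assms(3) by blast
  then show thesis using that by blast
qed

lemma length_ge_2_snoc:
  assumes "2 \<le> length xs"
  obtains ys y z where "xs = ys @ [y, z]"
proof -
  obtain us z where "xs = us @ [z]" using assms by (cases xs rule: rev_cases) auto
  moreover obtain ys y where "us = ys @ [y]"
    using assms \<open>xs = us @ [z]\<close> by (cases us rule: rev_cases) auto
  ultimately show thesis using that by simp
qed

text \<open>The last vertex of a longest path is a leaf.\<close>

lemma exists_leaf:
  assumes "finite V" "E \<subseteq> V \<times> V" "sym E" "irrefl E" "cycle_free E" "E \<noteq> {}"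
  obtains v p where "E `` {v} = {p}"
proof -
  obtain a b where ab: "(a, b) \<in> E" using assms(6) by auto
  let ?P = "\<lambda>xs. is_path E xs \<and> 2 \<le> length xs"
  have "?P [a, b]" using ab assms(4) by (auto simp: is_path_def irrefl_def)
  then obtain zs where zs: "?P zs" and max: "\<And>us. ?P us \<Longrightarrow> length us \<le> length zs"
    by (rule longest_path[OF assms(1,2), of ?P]) auto
  obtain ys y z where split: "zs = ys @ [y, z]" using zs length_ge_2_snoc by metis
  have "w = y" if "(z, w) \<in> E" for w
  proof (rule ccontr)
    assume "w \<noteq> y"
    then have "is_path E (ys @ [y, z, w])" using is_path_snoc assms(4,5) zs that split by metis
    then show False using max[of "ys @ [y, z, w]"] split by simp
  qed
  moreover have "(z, y) \<in> E"
    using zs assms(3) unfolding split is_path_def by (auto simp: successively_append_iff sym_def)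
  ultimately have "E `` {z} = {y}" by blast
  then show thesis using that by blast
qed

section \<open>Removing leaves, and the number of arcs of a tree\<close>

text \<open>A walk enters and leaves the leaf \<open>v\<close> only through \<open>p\<close>, so its
  visits to \<open>v\<close> can be contracted into \<open>p\<close>. The induction passes through
  walks that end at \<open>v\<close>; for these the contracted end is \<open>p\<close>.\<close>

lemma rtrancl_remove_leaf:
  assumes "(u, w) \<in> E\<^sup>*" "sym E" "E `` {v} = {p}" "u \<noteq> v"
    and "E' = E - {(v, p), (p, v)}"
  shows "(u, if w = v then p else w) \<in> E'\<^sup>*"
  using assms(1)
proof induction
  case base
  then show ?case using assms(4) by simp
next
  case (step y z)
  show ?case
  proof (cases "y = v \<or> z = v")
    case True
    have "y = v \<Longrightarrow> z = p" using step(2) assms(3) by auto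
    moreover have "z = v \<Longrightarrow> y = p" using step(2) assms(2,3) by (auto simp: sym_def)
    ultimately show ?thesis using True step(3) by (auto split: if_splits)
  next
    case False
    then show ?thesis using step(2,3) assms(5)
      by (auto intro: rtrancl_into_rtrancl)
  qed
qed

text \<open>Induction on the number of vertices: removing a leaf costs one vertex and two arcs,
  since each edge is stored in both directions. The additive form avoids truncated
  subtraction.\<close>

theorem card_arcs_tree:
  assumes "finite V" "V \<noteq> {}" "E \<subseteq> V \<times> V" "sym E" "irrefl E" "cycle_free E"
    and "\<And>u v. u \<in> V \<Longrightarrow> v \<in> V \<Longrightarrow> (u, v) \<in> E\<^sup>*"
  shows "card E + 2 = 2 * card V"
  using assms
proof (induction "card V" arbitrary: V E)
  case 0
  then show ?case by simp
next
  case (Suc m)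
  show ?case
  proof (cases "E = {}")
    case True
    then have "u = v" if "u \<in> V" "v \<in> V" for u v using Suc.prems(7)[OF that] by simp
    then have "card V \<le> Suc 0" using Suc.prems(1) by (subst card_le_Suc0_iff_eq) auto
    moreover have "card V \<noteq> 0" using Suc.prems(1,2) by simp
    ultimately show ?thesis using True by simp
  next
    case False
    then obtain v p where vp: "E `` {v} = {p}" using exists_leaf Suc.prems by metis
    define E' where "E' = E - {(v, p), (p, v)}"
    have E: "(v, p) \<in> E" "(p, v) \<in> E" using vp Suc.prems(4) by (auto simp: sym_def)
    then have V: "v \<in> V" "p \<in> V" and "v \<noteq> p"
      using Suc.prems(3,5) by (auto simp: irrefl_def)
    have only: "(v, x) \<in> E \<Longrightarrow> x = p" "(x, v) \<in> E \<Longrightarrow> x = p" for x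
      using vp Suc.prems(4) by (auto simp: sym_def)
    have path: "is_path E xs" if "is_path E' xs" for xs
      using that unfolding is_path_def E'_def by (auto elim: successively_mono)
    have "card E' + 2 = 2 * card (V - {v})"
    proof (rule Suc.hyps(1))
      show "m = card (V - {v})" using Suc.hyps(2) V(1) Suc.prems(1) by simp
      show "V - {v} \<noteq> {}" using V \<open>v \<noteq> p\<close> by blast
      show "E' \<subseteq> (V - {v}) \<times> (V - {v})" using only Suc.prems(3) unfolding E'_def by blast
      show "cycle_free E'" using Suc.prems(6) path unfolding cycle_free_def E'_def by blast
      show "(u, w) \<in> E'\<^sup>*" if "u \<in> V - {v}" "w \<in> V - {v}" for u w
        using rtrancl_remove_leaf[OF Suc.prems(7) Suc.prems(4) vp _ E'_def, of u w] that by auto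
    qed (use Suc.prems in \<open>auto simp: E'_def sym_def irrefl_def\<close>)
    moreover have "finite E" using Suc.prems(1,3) by (meson finite_SigmaI finite_subset)
    then have "card E = card E' + 2"
    proof -
      have "card E' = card E - card {(v, p), (p, v)}"
        unfolding E'_def using E by (intro card_Diff_subset) auto
      moreover have "card {(v, p), (p, v)} \<le> card E"
        using E \<open>finite E\<close> by (intro card_mono) auto
      moreover have "card {(v, p), (p, v)} = 2" using \<open>v \<noteq> p\<close> by simp
      ultimately show ?thesis by simp
    qed
    moreover have "card V = card (V - {v}) + 1"
      using V(1) Suc.prems(1) Suc.hyps(2) by simp
    ultimately show ?thesis by simp
  qed
qed

section \<open>Oriented segments and their first arcs\<close>

text \<open>The cardinality of the image of \<open>{v}\<close> is the degree of \<open>v\<close>.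
  Degree different from 2 stands for pendent or branching, which is the same where no degree is
  0.\<close>

definition oriented_segment :: "'a rel \<Rightarrow> 'a list \<Rightarrow> bool" where
  "oriented_segment E xs \<longleftrightarrow> is_path E xs \<and> 2 \<le> length xs \<and>
     card (E `` {hd xs}) \<noteq> 2 \<and> card (E `` {last xs}) \<noteq> 2 \<and>
     (\<forall>v \<in> set (butlast (tl xs)). card (E `` {v}) = 2)"

text \<open>A vertex of degree 2 has one neighbour besides its predecessor, so the next vertex is
  forced; and both continuations have to stop at the first vertex whose degree is not 2.\<close>

lemma path_continuation_unique:
  assumes "sym E"
    and "is_path E (x # y # as)" "\<forall>v \<in> set (butlast (y # as)). card (E `` {v}) = 2"
      "card (E `` {last (y # as)}) \<noteq> 2"
    and "is_path E (x # y # bs)" "\<forall>v \<in> set (butlast (y # bs)). card (E `` {v}) = 2"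
      "card (E `` {last (y # bs)}) \<noteq> 2"
  shows "as = bs"
  using assms(2-7)
proof (induction as arbitrary: x y bs)
  case Nil
  then show ?case by (cases bs) auto
next
  case (Cons a as)
  \<comment> \<open>Here \<open>y\<close> is internal to the first path and so has degree 2; hence
    the second path cannot end at \<open>y\<close> either.\<close>
  then obtain b bs' where bs: "bs = b # bs'" by (cases bs) auto
  have "card (E `` {y}) = 2" using Cons.prems(2) by simp
  then obtain s t where st: "E `` {y} = {s, t}" by (auto simp: card_2_iff)
  have "(y, x) \<in> E" "(y, a) \<in> E" "(y, b) \<in> E" "a \<noteq> x" "b \<noteq> x"
    using Cons.prems(1,4) assms(1) unfolding bs is_path_def by (auto simp: sym_def)
  then have "x \<in> {s, t}" "a \<in> {s, t}" "b \<in> {s, t}" "a \<noteq> x" "b \<noteq> x" using st by blast+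
  then have "a = b" by auto
  moreover have "as = bs'"
    using Cons.prems \<open>a = b\<close> unfolding bs is_path_def
    by (intro Cons.IH[of y a]) (auto simp: is_path_def)
  ultimately show ?case using bs by simp
qed

lemma oriented_segment_unique:
  assumes "sym E" "oriented_segment E xs" "oriented_segment E ys"
    and "hd xs = hd ys" "hd (tl xs) = hd (tl ys)"
  shows "xs = ys"
proof -
  obtain x y as where xs: "xs = x # y # as"
    using assms(2) unfolding oriented_segment_def by (cases xs; cases "tl xs") auto
  obtain bs where ys: "ys = x # y # bs"
    using assms(3-5) unfolding oriented_segment_def xs by (cases ys; cases "tl ys") auto
  show ?thesis
    using path_continuation_unique[OF assms(1), of x y as bs] assms(2,3)
    unfolding oriented_segment_def xs ys by simp
qed

text \<open>Among the paths that start with the arc \<open>(v, w)\<close> and have internal vertices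
  of degree 2, take a longest one. If its last vertex had degree 2, its second neighbour would
  extend the path, because no cycle can close.\<close>

lemma oriented_segment_exists:
  assumes "finite V" "E \<subseteq> V \<times> V" "irrefl E" "cycle_free E"
    and "(v, w) \<in> E" "card (E `` {v}) \<noteq> 2"
  obtains xs where "oriented_segment E xs" "hd xs = v" "hd (tl xs) = w"
proof -
  let ?P = "\<lambda>xs. (is_path E xs \<and> 2 \<le> length xs) \<and> hd xs = v \<and> hd (tl xs) = w \<and>
    (\<forall>u \<in> set (butlast (tl xs)). card (E `` {u}) = 2)"
  have "?P [v, w]" using assms(3,5) by (auto simp: is_path_def irrefl_def)
  then obtain xs where xs: "?P xs" and max: "\<And>us. ?P us \<Longrightarrow> length us \<le> length xs"
    by (rule longest_path[OF assms(1,2), of ?P]) auto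
  obtain ys y z where split: "xs = ys @ [y, z]" using xs length_ge_2_snoc by metis
  have "card (E `` {z}) \<noteq> 2"
  proof
    assume z: "card (E `` {z}) = 2"
    then obtain s t where "E `` {z} = {s, t}" "s \<noteq> t" by (auto simp: card_2_iff)
    then obtain u where "(z, u) \<in> E" "u \<noteq> y" by (metis Image_singleton_iff insertCI)
    then have "is_path E (ys @ [y, z, u])" using is_path_snoc assms(3,4) xs split by metis
    then have "?P (ys @ [y, z, u])"
      using xs z unfolding split by (cases ys) (auto simp: butlast_append hd_append split: if_splits)
    then show False using max[of "ys @ [y, z, u]"] split by simp
  qed
  then have "oriented_segment E xs"
    using xs assms(6) unfolding oriented_segment_def split by auto
  then show thesis using that xs by blast
qed

lemma oriented_segment_rev:
  assumes "sym E" "oriented_segment E xs"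
  shows "oriented_segment E (rev xs)"
proof -
  have "successively (\<lambda>x y. (y, x) \<in> E) xs \<longleftrightarrow> successively (\<lambda>x y. (x, y) \<in> E) xs"
    using assms(1) by (intro successively_cong) (auto simp: sym_def)
  moreover have "butlast (tl (rev xs)) = rev (butlast (tl xs))"
    by (metis butlast_rev butlast_tl rev_rev_ident)
  moreover have "xs \<noteq> []" using assms(2) by (auto simp: oriented_segment_def)
  ultimately show ?thesis
    using assms(2) unfolding oriented_segment_def is_path_def by (auto simp: hd_rev last_rev)
qed

lemma card_oriented_segments:
  assumes "finite V" "E \<subseteq> V \<times> V" "sym E" "irrefl E" "cycle_free E"
  shows "card {xs. oriented_segment E xs} = (\<Sum>v | v \<in> V \<and> card (E `` {v}) \<noteq> 2. card (E `` {v}))"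
    and "finite {xs. oriented_segment E xs}"
proof -
  \<comment> \<open>an oriented segment corresponds to its first arc\<close>
  let ?A = "SIGMA v : {v \<in> V. card (E `` {v}) \<noteq> 2}. E `` {v}"
  have "bij_betw (\<lambda>xs. (hd xs, hd (tl xs))) {xs. oriented_segment E xs} ?A"
  proof (rule bij_betw_imageI)
    show "inj_on (\<lambda>xs. (hd xs, hd (tl xs))) {xs. oriented_segment E xs}"
      using oriented_segment_unique[OF assms(3)] by (auto simp: inj_on_def)
    show "(\<lambda>xs. (hd xs, hd (tl xs))) ` {xs. oriented_segment E xs} = ?A"
    proof (intro equalityI subsetI)
      fix e assume "e \<in> (\<lambda>xs. (hd xs, hd (tl xs))) ` {xs. oriented_segment E xs}"
      then obtain xs where xs: "oriented_segment E xs" and e: "e = (hd xs, hd (tl xs))" by auto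
      obtain x y as where "xs = x # y # as"
        using xs unfolding oriented_segment_def by (cases xs; cases "tl xs") auto
      then show "e \<in> ?A"
        using xs e assms(2) unfolding oriented_segment_def is_path_def by auto
    next
      fix e assume "e \<in> ?A"
      then obtain v w where e: "e = (v, w)" "(v, w) \<in> E" "card (E `` {v}) \<noteq> 2" by auto
      obtain xs where "oriented_segment E xs" "hd xs = v" "hd (tl xs) = w"
        using oriented_segment_exists[OF assms(1,2,4,5) e(2,3)] .
      then show "e \<in> (\<lambda>xs. (hd xs, hd (tl xs))) ` {xs. oriented_segment E xs}"
        using e(1) by force
    qed
  qed
  moreover have "finite (E `` {v})" for v
    using assms(1,2) by (rule_tac finite_subset[of _ V]) auto
  ultimately show "card {xs. oriented_segment E xs} = (\<Sum>v | v \<in> V \<and> card (E `` {v}) \<noteq> 2. card (E `` {v}))"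
    and "finite {xs. oriented_segment E xs}"
    using assms(1) by (auto simp: bij_betw_same_card bij_betw_finite card_SigmaI)
qed

section \<open>From oriented segments to path subgraphs\<close>

lemma set_vwalk_arcs_rev: "set (vwalk_arcs (rev xs)) = (set (vwalk_arcs xs))\<inverse>"
proof (induction xs)
  case (Cons x xs)
  then show ?case
    by (cases "xs = []") (auto simp: set_vwalk_arcs_snoc last_rev)
qed simp

lemma path_graph_rev: "path_graph (rev xs) = path_graph xs"
  by (simp add: path_graph_def set_vwalk_arcs_rev Un_commute)

text \<open>As the vertices are distinct, the first one lies on the first edge only. Thus the
  subgraph together with a choice of starting end determines the first arc.\<close>

lemma path_graph_hd_arc:
  assumes "distinct xs" "2 \<le> length xs" "(hd xs, b) \<in> parcs (path_graph xs)"
  shows "b = hd (tl xs)"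
proof -
  obtain x y as where xs: "xs = x # y # as"
    using assms(2) by (cases xs; cases "tl xs") auto
  have "(x, b) \<notin> set (vwalk_arcs (y # as))" "(b, x) \<notin> set (vwalk_arcs (y # as))"
    using assms(1) arcs_in_vwalk_arcs[of _ "y # as"] unfolding xs by fastforce+
  then show ?thesis using assms(1,3) unfolding xs path_graph_def by auto
qed

lemma oriented_segment_ends:
  assumes "oriented_segment E xs" "v \<in> set xs" "card (E `` {v}) \<noteq> 2"
  shows "v = hd xs \<or> v = last xs"
proof -
  obtain x as where xs: "xs = x # as" "as \<noteq> []"
    using assms(1) unfolding oriented_segment_def by (cases xs; cases "tl xs") auto
  then have "set as = insert (last as) (set (butlast as))"
    by (metis append_butlast_last_id set_append list.simps(15) empty_set Un_insert_right sup_bot_right)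
  then show ?thesis using assms unfolding oriented_segment_def xs by auto
qed

text \<open>The head of \<open>ys\<close> has degree different from 2 and lies on \<open>xs\<close>,
  so it is an end of \<open>xs\<close>. The orientation of \<open>xs\<close> that starts there has
  the same first arc as \<open>ys\<close>, and the first arc determines an oriented segment.\<close>

lemma path_graph_eq_iff:
  assumes "sym E" "oriented_segment E xs" "oriented_segment E ys"
  shows "path_graph ys = path_graph xs \<longleftrightarrow> ys = xs \<or> ys = rev xs"
proof
  assume eq: "path_graph ys = path_graph xs"
  have same: "ys = zs" if zs: "oriented_segment E zs" "hd ys = hd zs" "path_graph ys = path_graph zs" for zs
  proof -
    obtain x y as where ys: "ys = x # y # as"
      using assms(3) unfolding oriented_segment_def by (cases ys; cases "tl ys") auto
    have "(hd ys, hd (tl ys)) \<in> parcs (path_graph ys)" unfolding ys path_graph_def by simp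
    then have "hd (tl ys) = hd (tl zs)"
      using path_graph_hd_arc[of zs] zs unfolding oriented_segment_def is_path_def by metis
    then show ?thesis using oriented_segment_unique[OF assms(1,3)] zs by blast
  qed
  have "hd ys \<in> set xs"
    using eq assms(3) unfolding oriented_segment_def path_graph_def by (cases ys) auto
  then have "hd ys = hd xs \<or> hd ys = hd (rev xs)"
    using oriented_segment_ends[OF assms(2)] assms(2,3) unfolding oriented_segment_def
    by (auto simp: hd_rev)
  then show "ys = xs \<or> ys = rev xs"
    using same[of xs] same[of "rev xs"] eq assms(2) oriented_segment_rev[OF assms(1,2)]
    by (auto simp: path_graph_rev)
qed (auto simp: path_graph_rev)

lemma oriented_segment_neq_rev:
  assumes "oriented_segment E xs"
  shows "rev xs \<noteq> xs"
proof -
  obtain x y as where xs: "xs = x # y # as"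
    using assms unfolding oriented_segment_def by (cases xs; cases "tl xs") auto
  then have "hd xs \<noteq> last xs"
    using assms last_in_set[of "y # as"] unfolding oriented_segment_def is_path_def by auto
  then show ?thesis using xs by (metis hd_rev)
qed

text \<open>Count by fibres of \<open>path_graph\<close>: each consists of a list and its reversal,
  which differ.\<close>

lemma card_path_graph_image:
  assumes "sym E" "finite {xs. oriented_segment E xs}"
  shows "2 * card (path_graph ` {xs. oriented_segment E xs}) = card {xs. oriented_segment E xs}"
proof -
  let ?O = "{xs. oriented_segment E xs}"
  have "card ?O = (\<Sum>P \<in> path_graph ` ?O. card {ys \<in> ?O. path_graph ys = P})"
    using sum.image_gen[OF assms(2), of "\<lambda>_. 1 :: nat" path_graph] by simp
  also have "\<dots> = (\<Sum>P \<in> path_graph ` ?O. 2)"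
  proof (rule sum.cong)
    fix P assume "P \<in> path_graph ` ?O"
    then obtain xs where xs: "oriented_segment E xs" "P = path_graph xs" by auto
    then have "{ys \<in> ?O. path_graph ys = P} = {xs, rev xs}"
      using path_graph_eq_iff[OF assms(1) xs(1)] oriented_segment_rev[OF assms(1) xs(1)] by auto
    then show "card {ys \<in> ?O. path_graph ys = P} = 2"
      using oriented_segment_neq_rev[OF xs(1)] by simp
  qed simp
  finally show ?thesis by simp
qed


section \<open>Trees and segments in terms of the arc relation\<close>

lemma successively_iff_vwalk_arcs:
  "successively (\<lambda>x y. (x, y) \<in> E) xs \<longleftrightarrow> set (vwalk_arcs xs) \<subseteq> E"
  by (induction xs rule: vwalk_arcs.induct) auto

lemma deg_eq_card_Image: "deg T v = card (parcs T `` {v})"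
proof -
  have "out_arcs (with_proj T) v = Pair v ` (parcs T `` {v})" by (auto simp: out_arcs_def)
  then show ?thesis by (simp add: out_degree_def card_image inj_on_def)
qed

lemma pawalk_verts_vwalk_arcs: "xs \<noteq> [] \<Longrightarrow> pawalk_verts (hd xs) (vwalk_arcs xs) = xs"
  by (induction xs rule: vwalk_arcs.induct) auto

lemma pcas_vwalk_arcs: "xs \<noteq> [] \<Longrightarrow> pcas (hd xs) (vwalk_arcs xs) (last xs)"
  by (induction xs rule: vwalk_arcs.induct) auto

text \<open>These are the hypotheses under which the counting lemmas above apply to
  \<open>parcs T\<close>.\<close>

lemma is_tree_relD:
  assumes "is_tree T"
  shows "finite (pverts T)" "pverts T \<noteq> {}" "parcs T \<subseteq> pverts T \<times> pverts T"
    "sym (parcs T)" "irrefl (parcs T)" "cycle_free (parcs T)"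
    and "\<And>u v. u \<in> pverts T \<Longrightarrow> v \<in> pverts T \<Longrightarrow> (u, v) \<in> (parcs T)\<^sup>*"
proof -
  interpret pair_graph T using assms by (simp add: is_tree_def)
  show "finite (pverts T)" by (rule pair_finite_verts)
  show E: "parcs T \<subseteq> pverts T \<times> pverts T" by (auto dest: wellformed')
  show sym: "sym (parcs T)" by (auto simp: sym_def arcs_symmetric)
  show "irrefl (parcs T)" using no_loops' by (auto simp: irrefl_def)
  \<comment> \<open>Connectedness is defined through the symmetric closure, which is
    \<open>T\<close> itself because its arcs are already symmetric.\<close>
  have mk: "mk_symmetric (with_proj T) = T"
    using sym unfolding mk_symmetric_def by (cases T) (auto simp: sym_def)
  then have conn: "strongly_connected (with_proj T)"
    using assms by (simp add: is_tree_def connected_def)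
  then show "pverts T \<noteq> {}" by (auto simp: strongly_connected_def)
  show "(u, v) \<in> (parcs T)\<^sup>*" if "u \<in> pverts T" "v \<in> pverts T" for u v
    using conn that by (auto simp: strongly_connected_def reachable_def dest: rtrancl_on_rtranclI)
  show "cycle_free (parcs T)"
    unfolding cycle_free_def
  proof (intro allI impI notI)
    fix xs assume xs: "is_path (parcs T) xs" "3 \<le> length xs" and closed: "(last xs, hd xs) \<in> parcs T"
    \<comment> \<open>Repeating the head closes the vertex list. The closed list has one vertex more
      than \<open>xs\<close>, hence exactly \<open>length xs\<close> arcs, and the bound 3 carries
      over to the cycle.\<close>
    let ?ys = "xs @ [hd xs]"
    have "xs \<noteq> []" using xs(2) by auto
    have "set (vwalk_arcs ?ys) \<subseteq> parcs T"
      using xs(1) closed \<open>xs \<noteq> []\<close> by (simp add: set_vwalk_arcs_snoc is_path_def successively_iff_vwalk_arcs)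
    moreover have "hd xs \<in> pverts T" using closed E by auto
    ultimately have "awalk (hd xs) (vwalk_arcs ?ys) (hd xs)"
      using pcas_vwalk_arcs[of ?ys] \<open>xs \<noteq> []\<close> by (simp add: awalk_def)
    moreover have "awalk_verts (hd xs) (vwalk_arcs ?ys) = ?ys"
      using pawalk_verts_vwalk_arcs[of ?ys] \<open>xs \<noteq> []\<close> by simp
    then have "distinct (tl (awalk_verts (hd xs) (vwalk_arcs ?ys)))"
      using xs(1) \<open>xs \<noteq> []\<close> by (cases xs) (auto simp: is_path_def)
    moreover have len: "length (vwalk_arcs ?ys) = length xs"
      using vwalk_length_simp[of ?ys] unfolding vwalk_length_def by simp
    moreover have "vwalk_arcs ?ys \<noteq> []" using len \<open>xs \<noteq> []\<close> by fastforce
    ultimately have "cycle (vwalk_arcs ?ys)" "3 \<le> length (vwalk_arcs ?ys)"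
      using xs(2) unfolding cycle_def by auto
    then show False using assms unfolding is_tree_def by blast
  qed
qed

text \<open>Symmetry of \<open>T\<close> supplies the reversed arcs. With at least two vertices in
  the list, each of them is an end of some arc, so the arcs alone place all vertices in
  \<open>T\<close>.\<close>

lemma subgraph_path_graph_iff:
  assumes "pair_graph T" "2 \<le> length xs"
  shows "subgraph (with_proj (path_graph xs)) (with_proj T) \<longleftrightarrow> set (vwalk_arcs xs) \<subseteq> parcs T"
    (is "?L \<longleftrightarrow> ?R")
proof
  assume ?L
  then show ?R by (auto simp: subgraph_def path_graph_def)
next
  interpret pair_graph T by (rule assms(1))
  assume R: ?R
  have "set (vwalk_arcs xs) \<subseteq> set xs \<times> set xs" using arcs_in_vwalk_arcs by fast
  then have "pair_wf_digraph (path_graph xs)"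
    by unfold_locales (auto simp: path_graph_def)
  moreover have "(set (vwalk_arcs xs))\<inverse> \<subseteq> parcs T" using R arcs_symmetric by auto
  moreover have "set xs \<subseteq> pverts T"
  proof
    fix v assume "v \<in> set xs"
    then have "\<exists>u. (u, v) \<in> set (vwalk_arcs xs) \<or> (v, u) \<in> set (vwalk_arcs xs)"
      using assms(2)
    proof (induction xs rule: vwalk_arcs.induct)
      case (3 x y zs)
      then show ?case by (cases zs) auto
    qed auto
    then show "v \<in> pverts T" using R wellformed' by blast
  qed
  moreover have "pair_wf_digraph T" by (rule pair_wf_digraph)
  ultimately show ?L
    using R by (auto simp: subgraph_def compatible_def wf_digraph_wp_iff path_graph_def)
qed

text \<open>Once degree 0 is excluded, being branching or pendent amounts to having degree different
  from 2.\<close>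

lemma segments_eq_image:
  assumes "pair_graph T" "\<And>v. v \<in> pverts T \<Longrightarrow> deg T v \<noteq> 0"
  shows "{P. is_segment T P} = path_graph ` {xs. oriented_segment (parcs T) xs}"
proof -
  have end_iff: "branching T v \<or> pendent T v \<longleftrightarrow> deg T v \<noteq> 2" if "v \<in> pverts T" for v
    using assms(2)[OF that] unfolding branching_def pendent_def by linarith
  have "is_segment T P \<longleftrightarrow> (\<exists>xs. P = path_graph xs \<and> oriented_segment (parcs T) xs)" for P
    unfolding is_segment_def
  proof (intro iffI; elim conjE exE)
    fix xs assume *: "subgraph (with_proj P) (with_proj T)" "distinct xs" "2 \<le> length xs" "P = path_graph xs"
      "branching T (hd xs) \<or> pendent T (hd xs)" "branching T (last xs) \<or> pendent T (last xs)"
      "\<forall>v \<in> set (butlast (tl xs)). deg T v = 2"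
    have "deg T (hd xs) \<noteq> 2" "deg T (last xs) \<noteq> 2"
      using *(5,6) unfolding branching_def pendent_def by linarith+
    then show "\<exists>xs. P = path_graph xs \<and> oriented_segment (parcs T) xs"
      using * subgraph_path_graph_iff[OF assms(1) *(3)]
      by (auto simp: oriented_segment_def is_path_def successively_iff_vwalk_arcs deg_eq_card_Image)
  next
    fix xs assume *: "P = path_graph xs" "oriented_segment (parcs T) xs"
    then have sub: "subgraph (with_proj P) (with_proj T)"
      using subgraph_path_graph_iff[OF assms(1)]
      by (auto simp: oriented_segment_def is_path_def successively_iff_vwalk_arcs)
    then have "set xs \<subseteq> pverts T" using *(1) by (simp add: subgraph_def path_graph_def)
    moreover have "xs \<noteq> []" using *(2) by (auto simp: oriented_segment_def)
    ultimately have "hd xs \<in> pverts T" "last xs \<in> pverts T" by auto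
    then show "subgraph (with_proj P) (with_proj T) \<and>
     (\<exists>xs. distinct xs \<and> 2 \<le> length xs \<and> P = path_graph xs \<and>
        (branching T (hd xs) \<or> pendent T (hd xs)) \<and>
        (branching T (last xs) \<or> pendent T (last xs)) \<and>
        (\<forall>v \<in> set (butlast (tl xs)). deg T v = 2))"
      using sub * end_iff
      by (auto simp: oriented_segment_def is_path_def deg_eq_card_Image intro!: exI[of _ xs])
  qed
  then show ?thesis by auto
qed

section \<open>Degree counts in a tree with a given number of segments\<close>

theorem tree_segment_count:
  assumes "is_tree T" "2 \<le> card (pverts T)"
  defines "S \<equiv> {v \<in> pverts T. deg T v \<noteq> 2}"
  defines "k \<equiv> card {P. is_segment T P}"
  shows "\<And>v. v \<in> pverts T \<Longrightarrow> 1 \<le> deg T v" and "card S = k + 1" and "(\<Sum>v\<in>S. deg T v) = 2 * k"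
proof -
  note T = is_tree_relD[OF assms(1)]
  show pos: "1 \<le> deg T v" if v: "v \<in> pverts T" for v
  proof -
    \<comment> \<open>Some second vertex is reachable from \<open>v\<close>, so an arc leaves
      \<open>v\<close>.\<close>
    have "pverts T \<noteq> {v}" using assms(2) by auto
    then obtain u where "u \<in> pverts T" "u \<noteq> v" using v by blast
    then have "(v, u) \<in> (parcs T)\<^sup>*" using T(7) v by blast
    then have "parcs T `` {v} \<noteq> {}"
      using \<open>u \<noteq> v\<close> by (auto elim: converse_rtranclE)
    moreover have "finite (parcs T `` {v})" using T(1,3) by (rule_tac finite_subset[of _ "pverts T"]) auto
    ultimately show ?thesis by (simp add: deg_eq_card_Image Suc_le_eq card_gt_0_iff)
  qed
  have deg_sum: "(\<Sum>v\<in>pverts T. deg T v) = card (parcs T)"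
  proof -
    have "parcs T = (SIGMA v : pverts T. parcs T `` {v})" using T(3) by auto
    moreover have "finite (parcs T `` {v})" for v using T(1,3) by (rule_tac finite_subset[of _ "pverts T"]) auto
    ultimately show ?thesis
      using T(1) card_SigmaI[of "pverts T" "\<lambda>v. parcs T `` {v}"] by (simp add: deg_eq_card_Image)
  qed
  have "{P. is_segment T P} = path_graph ` {xs. oriented_segment (parcs T) xs}"
    using assms(1) pos by (intro segments_eq_image) (force simp: is_tree_def)+
  then show sum: "(\<Sum>v\<in>S. deg T v) = 2 * k"
    using card_path_graph_image[OF T(4)] card_oriented_segments[OF T(1,3-6)]
    unfolding k_def S_def by (simp add: deg_eq_card_Image)
  have "(\<Sum>v\<in>pverts T. deg T v) = (\<Sum>v\<in>S. deg T v) + (\<Sum>v\<in>pverts T - S. deg T v)"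
    using T(1) unfolding S_def by (subst sum.subset_diff[of "{v \<in> pverts T. deg T v \<noteq> 2}"]) auto
  also have "(\<Sum>v\<in>pverts T - S. deg T v) = (\<Sum>v\<in>pverts T - S. 2)"
    by (intro sum.cong) (auto simp: S_def)
  also have "\<dots> = 2 * (card (pverts T) - card S)"
    using T(1) by (simp add: S_def card_Diff_subset)
  finally have "2 * k + 2 * (card (pverts T) - card S) + 2 = 2 * card (pverts T)"
    using deg_sum sum card_arcs_tree[OF T] by simp
  \<comment> \<open>This keeps the subtraction \<open>card (pverts T) - card S\<close> from being
    truncated.\<close>
  moreover have "card S \<le> card (pverts T)" using T(1) unfolding S_def by (intro card_mono) auto
  ultimately show "card S = k + 1" by simp
qed

section \<open>Strict convexity and the extremal degrees\<close>

text \<open>A function with strictly increasing derivative lies strictly below its chord from 1 to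
  \<open>k\<close>; the inequality is cleared of denominators. The mean value theorem on the two
  pieces cut off by \<open>d\<close> compares their slopes.\<close>

lemma strict_chord:
  fixes f f' :: "real \<Rightarrow> real"
  assumes "\<And>x. 1 \<le> x \<Longrightarrow> (f has_real_derivative f' x) (at x)"
    and "\<And>x y. 1 \<le> x \<Longrightarrow> x < y \<Longrightarrow> f' x < f' y"
    and "1 < d" "d < k"
  shows "(k - 1) * (f d - f 1) < (d - 1) * (f k - f 1)"
proof -
  obtain x where x: "1 < x" "x < d" "f d - f 1 = (d - 1) * f' x"
    using MVT2[of 1 d f f'] assms(1,3) by auto
  obtain y where y: "d < y" "y < k" "f k - f d = (k - d) * f' y"
    using MVT2[of d k f f'] assms(1,3,4) by (metis less_imp_le order_trans)
  have "f' x < f' y" using assms(2) x y by simp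
  then have "(d - 1) * (k - d) * f' x < (d - 1) * (k - d) * f' y"
    using assms(3,4) by simp
  then have "(k - d) * (f d - f 1) < (d - 1) * (f k - f d)"
    using x(3) y(3) by (simp add: mult_ac)
  \<comment> \<open>Adding \<open>(d - 1) * (f d - f 1)\<close> to both sides gives the
    claim.\<close>
  then show ?thesis by (simp add: algebra_simps)
qed

text \<open>If \<open>j\<close> of the \<open>k + 1\<close> values are \<open>k\<close> and the
  others are 1, the sum condition reads \<open>(k + 1 - j) + k * j = 2 * k\<close>, that is
  \<open>(k - 1) * (j - 1) = 0\<close> over the integers, so \<open>j = 1\<close>.\<close>

lemma image_mset_extremal_iff:
  fixes d :: "'a \<Rightarrow> nat"
  assumes "finite S" "card S = k + 1" "(\<Sum>v\<in>S. d v) = 2 * k" "2 \<le> k"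
  shows "image_mset d (mset_set S) = add_mset k (replicate_mset k 1) \<longleftrightarrow> (\<forall>v\<in>S. d v = 1 \<or> d v = k)"
proof
  assume *: "image_mset d (mset_set S) = add_mset k (replicate_mset k 1)"
  have "d ` S = set_mset (image_mset d (mset_set S))" using assms(1) by simp
  then have "d ` S \<subseteq> {1, k}" unfolding * by auto
  then show "\<forall>v\<in>S. d v = 1 \<or> d v = k" by auto
next
  assume *: "\<forall>v\<in>S. d v = 1 \<or> d v = k"
  define A where "A = {v \<in> S. d v = k}"
  have A: "A \<subseteq> S" "finite A" using assms(1) unfolding A_def by auto
  have ones: "d v = 1" if "v \<in> S - A" for v using * that unfolding A_def by auto
  have "(\<Sum>v\<in>S. d v) = (\<Sum>v\<in>S - A. d v) + (\<Sum>v\<in>A. d v)"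
    using A assms(1) by (rule_tac sum.subset_diff) auto
  also have "(\<Sum>v\<in>S - A. d v) = card S - card A" using ones A by (simp add: card_Diff_subset)
  also have "(\<Sum>v\<in>A. d v) = k * card A" by (simp add: A_def)
  finally have "2 * k = (k + 1 - card A) + k * card A" using assms(2,3) by simp
  moreover have "card A \<le> k + 1" using A assms(1,2) by (metis card_mono)
  ultimately have "(k - 1) * (card A - 1) = 0" if "card A \<ge> 1"
    using that assms(4) by (auto simp: algebra_simps)
  moreover have "card A \<ge> 1"
    using \<open>2 * k = (k + 1 - card A) + k * card A\<close> assms(4) by (cases "card A") auto
  ultimately have "card A = 1" using assms(4) by auto
  then obtain c where c: "A = {c}" by (auto simp: card_1_singleton_iff)
  then have "c \<in> S" "d c = k" using A_def by auto
  have "image_mset d (mset_set S) = add_mset (d c) (image_mset d (mset_set (S - {c})))"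
    using \<open>c \<in> S\<close> assms(1) by (simp add: mset_set.remove)
  also have "image_mset d (mset_set (S - {c})) = image_mset (\<lambda>_. 1) (mset_set (S - {c}))"
    using ones assms(1) unfolding c by (intro image_mset_cong) auto
  also have "\<dots> = replicate_mset k 1"
    using \<open>c \<in> S\<close> assms(1,2) by (simp add: image_mset_const_eq)
  finally show "image_mset d (mset_set S) = add_mset k (replicate_mset k 1)" using \<open>d c = k\<close> by simp
qed

text \<open>Replace \<open>f\<close> by its chord through 1 and \<open>k\<close>: being affine, the
  chord has a sum over \<open>S\<close> that depends only on \<open>card S\<close> and the sum of
  the \<open>d v\<close>, and this sum is \<open>f k + real k * f 1\<close>. Since \<open>f\<close>
  is below the chord between the ends, equality forces every value to be 1 or
  \<open>k\<close>.\<close>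

lemma strict_chord_sum:
  fixes f :: "nat \<Rightarrow> real" and d :: "'a \<Rightarrow> nat"
  assumes "finite S" "card S = k + 1" "(\<Sum>v\<in>S. d v) = 2 * k" "\<And>v. v \<in> S \<Longrightarrow> 1 \<le> d v" "2 \<le> k"
    and chord: "\<And>m. 1 < m \<Longrightarrow> m < k \<Longrightarrow> (real k - 1) * (f m - f 1) < (real m - 1) * (f k - f 1)"
  shows "(\<Sum>v\<in>S. f (d v)) \<le> f k + real k * f 1"
    and "(\<Sum>v\<in>S. f (d v)) = f k + real k * f 1 \<longleftrightarrow> (\<forall>v\<in>S. d v = 1 \<or> d v = k)"
proof -
  \<comment> \<open>the deficit of \<open>f\<close> below its chord through 1 and \<open>k\<close>, scaled by \<open>k - 1\<close>\<close>
  define g where "g m = (real m - 1) * (f k - f 1) - (real k - 1) * (f m - f 1)" for m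
  have sum: "(\<Sum>v\<in>S. real (d v)) = 2 * real k" using assms(3) by (metis of_nat_mult of_nat_numeral of_nat_sum)
  \<comment> \<open>The excesses over 1 are nonnegative and total \<open>2 * k - (k + 1)\<close>, so
    no single value exceeds \<open>k\<close> and all values lie in the range of the chord.\<close>
  have excess: "(\<Sum>v\<in>S. d v - 1) = k - 1"
    using assms(2-4) by (subst sum_subtractf_nat) auto
  have le: "d v \<le> k" if "v \<in> S" for v
    using member_le_sum[of v S "\<lambda>v. d v - 1"] that assms(1,5) excess by auto
  have g0: "g m \<ge> 0" "g m = 0 \<longleftrightarrow> m = 1 \<or> m = k" if "1 \<le> m" "m \<le> k" for m
    using chord[of m] that unfolding g_def by (cases "m = 1"; cases "m = k"; force)+
  have "(\<Sum>v\<in>S. g (d v)) = (real k - 1) * (f k - f 1)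
      - (real k - 1) * ((\<Sum>v\<in>S. f (d v)) - (real k + 1) * f 1)"
    using assms(2) sum unfolding g_def
    by (simp add: sum_subtractf flip: sum_distrib_left sum_distrib_right)
  then have eq: "(\<Sum>v\<in>S. g (d v)) = (real k - 1) * (f k + real k * f 1 - (\<Sum>v\<in>S. f (d v)))"
    by (simp add: algebra_simps)
  have "(\<Sum>v\<in>S. g (d v)) \<ge> 0" using g0(1) le assms(4) by (intro sum_nonneg) auto
  then show "(\<Sum>v\<in>S. f (d v)) \<le> f k + real k * f 1"
    unfolding eq using assms(5) by (simp add: zero_le_mult_iff)
  have "(\<Sum>v\<in>S. f (d v)) = f k + real k * f 1 \<longleftrightarrow> (\<Sum>v\<in>S. g (d v)) = 0"
    unfolding eq using assms(5) by auto
  also have "\<dots> \<longleftrightarrow> (\<forall>v\<in>S. g (d v) = 0)"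
    using g0(1) le assms(1,4) by (intro sum_nonneg_eq_0_iff) auto
  also have "\<dots> \<longleftrightarrow> (\<forall>v\<in>S. d v = 1 \<or> d v = k)" using g0(2) le assms(4) by blast
  finally show "(\<Sum>v\<in>S. f (d v)) = f k + real k * f 1 \<longleftrightarrow> (\<forall>v\<in>S. d v = 1 \<or> d v = k)" .
qed

section \<open>The bound for a general convex degree function\<close>

text \<open>A nonincreasing list is determined by its multiset.\<close>

lemma degree_sequence_eq_iff:
  assumes "sorted (rev ds)"
  shows "degree_sequence T = ds \<longleftrightarrow> image_mset (deg T) (mset_set (pverts T)) = mset ds"
proof -
  have "sort (rev ds) = rev ds" using assms by (rule sort_key_id_if_sorted[of "\<lambda>x. x", simplified])
  then show ?thesis
    unfolding degree_sequence_def
    by (metis mset_rev mset_sorted_list_of_multiset rev_rev_ident sorted_list_of_multiset_mset)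
qed

text \<open>The \<open>n - k - 1\<close> vertices of degree 2 contribute a fixed amount, so only the
  remaining \<open>k + 1\<close> vertices matter. All three index inequalities are instances of this
  for suitable \<open>f\<close>.\<close>

lemma tree_degree_sum_bound:
  fixes f :: "nat \<Rightarrow> real"
  assumes "is_tree T" "card (pverts T) = n" "card {P. is_segment T P} = k" "3 \<le> k" "k \<le> n - 2"
    and chord: "\<And>m. 1 < m \<Longrightarrow> m < k \<Longrightarrow> (real k - 1) * (f m - f 1) < (real m - 1) * (f k - f 1)"
  shows "(\<Sum>v\<in>pverts T. f (deg T v)) \<le> f k + real k * f 1 + (real n - real k - 1) * f 2"
    and "(\<Sum>v\<in>pverts T. f (deg T v)) = f k + real k * f 1 + (real n - real k - 1) * f 2 \<longleftrightarrow>
      degree_sequence T = k # replicate (n - k - 1) 2 @ replicate k 1"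
proof -
  define S where "S = {v \<in> pverts T. deg T v \<noteq> 2}"
  have n: "2 \<le> card (pverts T)" using assms(2,4,5) by simp
  note count = tree_segment_count[OF assms(1) n]
  have fin: "finite (pverts T)" by (rule is_tree_relD(1)[OF assms(1)])
  then have S: "finite S" "S \<subseteq> pverts T" "card S = k + 1" "(\<Sum>v\<in>S. deg T v) = 2 * k" "\<And>v. v \<in> S \<Longrightarrow> 1 \<le> deg T v"
    using count assms(3) unfolding S_def by auto
  have two: "deg T v = 2" if "v \<in> pverts T - S" for v using that unfolding S_def by auto
  have card: "card (pverts T - S) = n - k - 1" using S assms(2) by (simp add: card_Diff_subset)
  have "(\<Sum>v\<in>pverts T. f (deg T v)) = (\<Sum>v\<in>pverts T - S. f (deg T v)) + (\<Sum>v\<in>S. f (deg T v))"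
    using fin S(2) by (rule_tac sum.subset_diff) auto
  also have "(\<Sum>v\<in>pverts T - S. f (deg T v)) = (real n - real k - 1) * f 2"
    using two card assms(4,5) by (simp add: of_nat_diff)
  finally have split: "(\<Sum>v\<in>pverts T. f (deg T v)) = (real n - real k - 1) * f 2 + (\<Sum>v\<in>S. f (deg T v))" .
  have "2 \<le> k" using assms(4) by simp
  note bound = strict_chord_sum[OF S(1,3-5) this chord]
  show "(\<Sum>v\<in>pverts T. f (deg T v)) \<le> f k + real k * f 1 + (real n - real k - 1) * f 2"
    using split bound(1) by simp
  have "pverts T = S \<union> (pverts T - S)" using S(2) by blast
  then have "image_mset (deg T) (mset_set (pverts T))
      = image_mset (deg T) (mset_set S) + image_mset (deg T) (mset_set (pverts T - S))"
    using S(1) fin mset_set_Union[of S "pverts T - S"] by (metis Diff_disjoint finite_Diff image_mset_union)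
  also have "image_mset (deg T) (mset_set (pverts T - S)) = image_mset (\<lambda>_. 2) (mset_set (pverts T - S))"
    using two fin by (intro image_mset_cong) auto
  also have "\<dots> = replicate_mset (n - k - 1) 2" using card by (simp add: image_mset_const_eq)
  finally have mset: "image_mset (deg T) (mset_set (pverts T))
      = image_mset (deg T) (mset_set S) + replicate_mset (n - k - 1) 2" .
  have "sorted (rev (k # replicate (n - k - 1) 2 @ replicate k 1))"
    using assms(4) by (auto simp: sorted_append)
  \<comment> \<open>The entries 2 contributed by the complement of \<open>S\<close> cancel on both
    sides.\<close>
  then have "degree_sequence T = k # replicate (n - k - 1) 2 @ replicate k 1 \<longleftrightarrow>
      image_mset (deg T) (mset_set S) = add_mset k (replicate_mset k 1)"
    by (simp add: degree_sequence_eq_iff mset)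
  then show "(\<Sum>v\<in>pverts T. f (deg T v)) = f k + real k * f 1 + (real n - real k - 1) * f 2 \<longleftrightarrow>
      degree_sequence T = k # replicate (n - k - 1) 2 @ replicate k 1"
    using split bound(2) image_mset_extremal_iff[OF S(1,3,4) \<open>2 \<le> k\<close>] by simp
qed

section \<open>The chord inequality for the index functions\<close>

text \<open>The derivative \<alpha> times \<open>x powr (\<alpha> - 1)\<close> is strictly
  increasing in both ranges: for negative \<alpha> the power decreases, but its factor is
  negative.\<close>

lemma powr_chord:
  fixes \<alpha> :: real
  assumes "\<alpha> < 0 \<or> 1 < \<alpha>" "1 < m" "m < k"
  shows "(real k - 1) * (real m powr \<alpha> - real 1 powr \<alpha>) < (real m - 1) * (real k powr \<alpha> - real 1 powr \<alpha>)"
proof -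
  have deriv: "((\<lambda>x. x powr \<alpha>) has_real_derivative \<alpha> * x powr (\<alpha> - 1)) (at x)" if "1 \<le> x" for x
    using that by (auto intro!: derivative_eq_intros)
  have "\<alpha> * x powr (\<alpha> - 1) < \<alpha> * y powr (\<alpha> - 1)" if "1 \<le> x" "x < y" for x y
    using assms(1) that powr_less_mono2[of "\<alpha> - 1" x y] powr_less_mono2_neg[of "\<alpha> - 1" x y] by auto
  from strict_chord[OF deriv this, of "real m" "real k"] show ?thesis using assms(2,3) by simp
qed

text \<open>For exponents between 0 and 1 the power is strictly concave, so its negative takes the
  role of \<open>f\<close>.\<close>

lemma neg_powr_chord:
  fixes \<alpha> :: real
  assumes "0 < \<alpha>" "\<alpha> < 1" "1 < m" "m < k"
  shows "(real k - 1) * (- (real m powr \<alpha>) - - (real 1 powr \<alpha>)) < (real m - 1) * (- (real k powr \<alpha>) - - (real 1 powr \<alpha>))"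
proof -
  have deriv: "((\<lambda>x. - (x powr \<alpha>)) has_real_derivative - (\<alpha> * x powr (\<alpha> - 1))) (at x)" if "1 \<le> x" for x
    using that by (auto intro!: derivative_eq_intros)
  have "- (\<alpha> * x powr (\<alpha> - 1)) < - (\<alpha> * y powr (\<alpha> - 1))" if "1 \<le> x" "x < y" for x y
    using assms(1,2) that powr_less_mono2_neg[of "\<alpha> - 1" x y] by auto
  from strict_chord[OF deriv this, of "real m" "real k"] show ?thesis using assms(3,4) by simp
qed

text \<open>For differentiation \<open>a ^ m\<close> is extended to \<open>a powr x\<close>. As
  \<open>ln a\<close> is positive, the derivative is a product of two positive increasing
  factors.\<close>

lemma exdeg_chord:
  fixes a :: real
  assumes "1 < a" "1 < m" "m < k"
  shows "(real k - 1) * (real m * a ^ m - real 1 * a ^ 1) < (real m - 1) * (real k * a ^ k - real 1 * a ^ 1)"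
proof -
  have deriv: "((\<lambda>x. x * a powr x) has_real_derivative (1 + x * ln a) * a powr x) (at x)" if "1 \<le> x" for x
    using assms(1) by (auto intro!: derivative_eq_intros simp: algebra_simps)
  have "(1 + x * ln a) * a powr x < (1 + y * ln a) * a powr y" if "1 \<le> x" "x < y" for x y
    using assms(1) that by (intro mult_strict_mono) (auto intro: add_pos_pos)
  from strict_chord[OF deriv this, of "real m" "real k"] show ?thesis
    using assms by (simp add: powr_realpow)
qed

theorem theorem4p3:
  fixes T :: "'a pair_pre_digraph" and n k :: nat
  assumes "n \<ge> 6" and "3 \<le> k" and "k \<le> n - 2"
    and "is_tree T" and "card (pverts T) = n" and "card {P. is_segment T P} = k"
  defines "extremal \<equiv> (degree_sequence T = k # replicate (n - k - 1) 2 @ replicate k 1)"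
    and "R_bound \<equiv> (\<lambda>\<alpha>::real. 2 powr \<alpha> * real n + real k powr \<alpha> - (2 powr \<alpha> - 1) * real k - 2 powr \<alpha>)"
    and "SEI_bound \<equiv> (\<lambda>a::real. 2 * a\<^sup>2 * real n + real k * a ^ k - (2 * a - 1) * a * real k - 2 * a\<^sup>2)"
  shows "(\<forall>\<alpha>::real. \<alpha> < 0 \<or> \<alpha> > 1 \<longrightarrow>
            zeroth_order_Randic \<alpha> T \<le> R_bound \<alpha> \<and>
            (zeroth_order_Randic \<alpha> T = R_bound \<alpha> \<longleftrightarrow> extremal)) \<and>
         (\<forall>\<alpha>::real. 0 < \<alpha> \<and> \<alpha> < 1 \<longrightarrow>
            zeroth_order_Randic \<alpha> T \<ge> R_bound \<alpha> \<and>
            (zeroth_order_Randic \<alpha> T = R_bound \<alpha> \<longleftrightarrow> extremal)) \<and>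
         (\<forall>a::real. a > 1 \<longrightarrow>
            SEI a T \<le> SEI_bound a \<and>
            (SEI a T = SEI_bound a \<longleftrightarrow> extremal))"
proof (intro conjI allI impI)
  note bounds = tree_degree_sum_bound[OF assms(4,5,6,2,3)]
  {
    fix \<alpha> :: real assume "\<alpha> < 0 \<or> \<alpha> > 1"
    note * = bounds[of "\<lambda>m. real m powr \<alpha>", OF powr_chord[OF this]]
    have "R_bound \<alpha> = real k powr \<alpha> + real k * real 1 powr \<alpha> + (real n - real k - 1) * real 2 powr \<alpha>"
      unfolding R_bound_def by (simp add: algebra_simps)
    with * show "zeroth_order_Randic \<alpha> T \<le> R_bound \<alpha>" "zeroth_order_Randic \<alpha> T = R_bound \<alpha> \<longleftrightarrow> extremal"
      unfolding zeroth_order_Randic_def extremal_def by simp_all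
  next
    fix \<alpha> :: real assume "0 < \<alpha> \<and> \<alpha> < 1"
    then have \<alpha>: "0 < \<alpha>" "\<alpha> < 1" by auto
    \<comment> \<open>The upper bound for the negated sum is the lower bound for the index.\<close>
    note * = bounds[of "\<lambda>m. - (real m powr \<alpha>)", OF neg_powr_chord[OF \<alpha>]]
    have "- R_bound \<alpha> = - (real k powr \<alpha>) + real k * - (real 1 powr \<alpha>) + (real n - real k - 1) * - (real 2 powr \<alpha>)"
      unfolding R_bound_def by (simp add: algebra_simps)
    moreover have "(\<Sum>v\<in>pverts T. - (real (deg T v) powr \<alpha>)) = - zeroth_order_Randic \<alpha> T"
      unfolding zeroth_order_Randic_def by (rule sum_negf)
    ultimately have "- zeroth_order_Randic \<alpha> T \<le> - R_bound \<alpha>"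
      "- zeroth_order_Randic \<alpha> T = - R_bound \<alpha> \<longleftrightarrow> extremal"
      using * unfolding extremal_def by (simp_all only:)
    then show "zeroth_order_Randic \<alpha> T \<ge> R_bound \<alpha>" "zeroth_order_Randic \<alpha> T = R_bound \<alpha> \<longleftrightarrow> extremal"
      by simp_all
  next
    fix a :: real assume "a > 1"
    note * = bounds[of "\<lambda>m. real m * a ^ m", OF exdeg_chord[OF this]]
    have "SEI_bound a = real k * a ^ k + real k * (real 1 * a ^ 1) + (real n - real k - 1) * (real 2 * a ^ 2)"
      unfolding SEI_bound_def by (simp add: algebra_simps power2_eq_square)
    with * show "SEI a T \<le> SEI_bound a" "SEI a T = SEI_bound a \<longleftrightarrow> extremal"
      unfolding SEI_def extremal_def by simp_all
  }
qed

end
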